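(* In the model described in the context, for either the PS-EH or the TS-EH protocol and any fixed $\rho\in(0,1)$, as the number $L$ of relay antennas tends to infinity (all other parameters fixed), the throughput difference $\tau_{in}-\tau$ saturates to a fixed value: $$\lim_{L\to\infty}(\tau_{in}-\tau)=\frac{\tfrac12\zeta R_s}{1+\frac{\lambda_{sd}\psi}{\lambda_{sp}}}=\tfrac12\,\zeta\,\tau_{dir}.$$
   Context: Random channel model. Let $L\ge 1$ be an integer (number of relay antennas) and let $\lambda_{sr},\lambda_{rd},\lambda_{sd},\lambda_{sp},\lambda_{rp}>0$. The following random variables are mutually independent complex circular Gaussians: $h^i_{sr}\sim\mathcal{CN}(0,\lambda_{sr}^{-1})$ ($i=1,\dots,L$), $h^j_{rd}\sim\mathcal{CN}(0,\lambda_{rd}^{-1})$ and $g^j_{rp}\sim\mathcal{CN}(0,\lambda_{rp}^{-1})$ ($j=1,\dots,L$), $h_{sd}\sim\mathcal{CN}(0,\lambda_{sd}^{-1})$, $g_{sp}\sim\mathcal{CN}(0,\lambda_{sp}^{-1})$. Thus the squared moduli are independent exponentials with rates $\lambda_{sr},\lambda_{rd},\lambda_{rp},\lambda_{sd},\lambda_{sp}$, respectively. Put $\|\bm h_{sr}\|^2=\sum_{i=1}^L|h^i_{sr}|^2$. Constants: interference limit $I>0$, noise power $N_o>0$, harvesting efficiency $\eta\in(0,1]$, target rate $R_s>0$, threshold $\gamma_{th}=2^{2R_s}-1$, and $\psi=\frac{\gamma_{th}}{I/N_o}$. The energy-harvesting parameter is $\rho\in(0,1)$. Protocol-dependent parameters: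 for power splitting (PS-EH), $\xi=1-\rho$, $\beta=\eta\rho$, $\zeta=1$; for time switching (TS-EH), $\xi=1$, $\beta=\frac{2\eta\rho}{1-\rho}$, $\zeta=1-\rho$. Source power: $P_s=I/|g_{sp}|^2$. SNRs: $$\Gamma_r=\frac{\xi P_s\|\bm h_{sr}\|^2}{N_o},\qquad \Gamma_{d_1}=\frac{P_s|h_{sd}|^2}{N_o},\qquad \Gamma_d^{j}=\frac{1}{N_o}\min\Big(\beta P_s\|\bm h_{sr}\|^2,\frac{I}{|g^j_{rp}|^2}\Big)|h^j_{rd}|^2+\Gamma_{d_1}.$$ The selected relay antenna is $\hat j=\arg\max_j\Gamma_d^j$. Cooperative scheme: outage $p=\Pr[\min(\Gamma_r,\Gamma_d^{\hat j})<\gamma_{th}]$, throughput $\tau=\tfrac12R_s\zeta(1-p)$. Incremental relaying scheme: throughput $$\tau_{in}=\zeta\Big(\tfrac12R_s\Pr\big[\Gamma_{d_1}<\gamma_{th},\ \Gamma_r\ge\gamma_{th},\ \Gamma_d^{\hat j}\ge\gamma_{th}\big]+R_s\Pr[\Gamma_{d_1}\ge\gamma_{th}]\Big).$$ Direct (relay-less) communication: throughput $\tau_{dir}=R_s\Pr\big[\tfrac{P_s|h_{sd}|^2}{N_o}\ge\gamma_{th}\big]$, which equals $\frac{R_s}{1+\lambda_{sd}\psi/\lambda_{sp}}$. *)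

theory Defs
  imports "HOL-Probability.Probability"
begin

datatype eh_protocol = PS_EH | TS_EH

record relay_params =
  lam_sr :: real
  lam_rd :: real
  lam_sd :: real
  lam_sp :: real
  lam_rp :: real
  I_lim :: real      \<comment> \<open>interference limit \<open>I\<close>\<close>
  N_o :: real        \<comment> \<open>noise power\<close>
  eta :: real        \<comment> \<open>harvesting efficiency\<close>
  R_s :: real        \<comment> \<open>target rate\<close>
  rho :: real        \<comment> \<open>energy-harvesting parameter\<close>
  protocol :: eh_protocol

definition admissible :: "relay_params \<Rightarrow> bool" where
  "admissible P \<longleftrightarrow>
     lam_sr P > 0 \<and> lam_rd P > 0 \<and> lam_sd P > 0 \<and> lam_sp P > 0 \<and> lam_rp P > 0 \<and>
     I_lim P > 0 \<and> N_o P > 0 \<and> 0 < eta P \<and> eta P \<le> 1 \<and> R_s P > 0 \<and>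
     0 < rho P \<and> rho P < 1"

definition gamma_th :: "relay_params \<Rightarrow> real" where
  "gamma_th P = 2 powr (2 * R_s P) - 1"

definition psi :: "relay_params \<Rightarrow> real" where
  "psi P = gamma_th P / (I_lim P / N_o P)"

definition xi :: "relay_params \<Rightarrow> real" where
  "xi P = (case protocol P of PS_EH \<Rightarrow> 1 - rho P | TS_EH \<Rightarrow> 1)"

definition beta :: "relay_params \<Rightarrow> real" where
  "beta P = (case protocol P of PS_EH \<Rightarrow> eta P * rho P
                              | TS_EH \<Rightarrow> 2 * eta P * rho P / (1 - rho P))"

definition zeta :: "relay_params \<Rightarrow> real" where
  "zeta P = (case protocol P of PS_EH \<Rightarrow> 1 | TS_EH \<Rightarrow> 1 - rho P)"

text \<open>
  All channel coefficients form one family indexed by links, so that their mutual independence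
  is a single statement: \<open>h (SR i)\<close>, \<open>h (RD j)\<close>, \<open>h (RP j)\<close>, \<open>h SD\<close>, \<open>h SP\<close> are the
  coefficients $h_{sr}^i$, $h_{rd}^j$, $g_{rp}^j$, $h_{sd}$, $g_{sp}$.
\<close>

datatype link = SR nat | RD nat | RP nat | SD | SP

definition links :: "nat \<Rightarrow> link set" where
  "links L = SR ` {1..L} \<union> RD ` {1..L} \<union> RP ` {1..L} \<union> {SD, SP}"

fun link_rate :: "relay_params \<Rightarrow> link \<Rightarrow> real" where
  "link_rate P (SR i) = lam_sr P"
| "link_rate P (RD j) = lam_rd P"
| "link_rate P (RP j) = lam_rp P"
| "link_rate P SD = lam_sd P"
| "link_rate P SP = lam_sp P"

text \<open>
  Density of the circular Gaussian law $\mathcal{CN}(0,v)$ with respect to Lebesgue measure on the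
  complex plane; here $v$ is the total variance $\mathbf{E}|Z|^2$, so the real and imaginary parts
  are independent with variance $v/2$ each.
\<close>

definition circ_normal_density :: "real \<Rightarrow> complex \<Rightarrow> real" where
  "circ_normal_density v z = exp (- (cmod z)\<^sup>2 / v) / (pi * v)"

definition channel_model ::
  "relay_params \<Rightarrow> nat \<Rightarrow> 'a measure \<Rightarrow> (link \<Rightarrow> 'a \<Rightarrow> complex) \<Rightarrow> bool" where
  "channel_model P L M h \<longleftrightarrow>
     prob_space M \<and>
     prob_space.indep_vars M (\<lambda>_. borel) h (links L) \<and>
     (\<forall>l\<in>links L. distributed M lborel (h l)
        (\<lambda>z. ennreal (circ_normal_density (inverse (link_rate P l)) z)))"

definition source_power :: "relay_params \<Rightarrow> (link \<Rightarrow> 'a \<Rightarrow> complex) \<Rightarrow> 'a \<Rightarrow> real" where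
  "source_power P h \<omega> = I_lim P / (cmod (h SP \<omega>))\<^sup>2"

definition norm_sr_sq :: "nat \<Rightarrow> (link \<Rightarrow> 'a \<Rightarrow> complex) \<Rightarrow> 'a \<Rightarrow> real" where
  "norm_sr_sq L h \<omega> = (\<Sum>i=1..L. (cmod (h (SR i) \<omega>))\<^sup>2)"

definition Gamma_r :: "relay_params \<Rightarrow> nat \<Rightarrow> (link \<Rightarrow> 'a \<Rightarrow> complex) \<Rightarrow> 'a \<Rightarrow> real" where
  "Gamma_r P L h \<omega> = xi P * source_power P h \<omega> * norm_sr_sq L h \<omega> / N_o P"

definition Gamma_d1 :: "relay_params \<Rightarrow> (link \<Rightarrow> 'a \<Rightarrow> complex) \<Rightarrow> 'a \<Rightarrow> real" where
  "Gamma_d1 P h \<omega> = source_power P h \<omega> * (cmod (h SD \<omega>))\<^sup>2 / N_o P"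

definition Gamma_d ::
  "relay_params \<Rightarrow> nat \<Rightarrow> (link \<Rightarrow> 'a \<Rightarrow> complex) \<Rightarrow> nat \<Rightarrow> 'a \<Rightarrow> real" where
  "Gamma_d P L h j \<omega> =
     1 / N_o P * min (beta P * source_power P h \<omega> * norm_sr_sq L h \<omega>)
                     (I_lim P / (cmod (h (RP j) \<omega>))\<^sup>2) * (cmod (h (RD j) \<omega>))\<^sup>2
     + Gamma_d1 P h \<omega>"

definition selected_antenna ::
  "relay_params \<Rightarrow> nat \<Rightarrow> (link \<Rightarrow> 'a \<Rightarrow> complex) \<Rightarrow> 'a \<Rightarrow> nat" where
  "selected_antenna P L h \<omega> = arg_max_on (\<lambda>j. Gamma_d P L h j \<omega>) {1..L}"

definition Gamma_d_sel :: "relay_params \<Rightarrow> nat \<Rightarrow> (link \<Rightarrow> 'a \<Rightarrow> complex) \<Rightarrow> 'a \<Rightarrow> real" where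
  "Gamma_d_sel P L h \<omega> = Gamma_d P L h (selected_antenna P L h \<omega>) \<omega>"

definition outage ::
  "relay_params \<Rightarrow> nat \<Rightarrow> 'a measure \<Rightarrow> (link \<Rightarrow> 'a \<Rightarrow> complex) \<Rightarrow> real" where
  "outage P L M h = \<P>(\<omega> in M. min (Gamma_r P L h \<omega>) (Gamma_d_sel P L h \<omega>) < gamma_th P)"

definition tau_coop ::
  "relay_params \<Rightarrow> nat \<Rightarrow> 'a measure \<Rightarrow> (link \<Rightarrow> 'a \<Rightarrow> complex) \<Rightarrow> real" where
  "tau_coop P L M h = 1 / 2 * R_s P * zeta P * (1 - outage P L M h)"

definition tau_in ::
  "relay_params \<Rightarrow> nat \<Rightarrow> 'a measure \<Rightarrow> (link \<Rightarrow> 'a \<Rightarrow> complex) \<Rightarrow> real" where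
  "tau_in P L M h =
     zeta P * (1 / 2 * R_s P * \<P>(\<omega> in M. Gamma_d1 P h \<omega> < gamma_th P \<and>
                                          Gamma_r P L h \<omega> \<ge> gamma_th P \<and>
                                          Gamma_d_sel P L h \<omega> \<ge> gamma_th P)
               + R_s P * \<P>(\<omega> in M. Gamma_d1 P h \<omega> \<ge> gamma_th P))"

definition tau_dir ::
  "relay_params \<Rightarrow> 'a measure \<Rightarrow> (link \<Rightarrow> 'a \<Rightarrow> complex) \<Rightarrow> real" where
  "tau_dir P M h =
     R_s P * \<P>(\<omega> in M. source_power P h \<omega> * (cmod (h SD \<omega>))\<^sup>2 / N_o P \<ge> gamma_th P)"

end

(* Since Gamma_d^j >= Gamma_d1 for every antenna, a direct link that is not in outage makes the
   cooperative scheme fail only through Gamma_r. With A the event Gamma_d1 >= gamma_th and C the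
   event of cooperative success, tau_in - tau = zeta R_s (P(A) - P(A and C) / 2), and
   P(A) - P(A and C) <= P(Gamma_r < gamma_th), which vanishes because ||h_sr||^2 dominates each of
   L independent exponentials. P(A) itself is the probability that one exponential variable exceeds
   a multiple of another one. *)

theory Submission
  imports Defs "HOL-Real_Asymp.Real_Asymp"
begin

section \<open>From circular Gaussians to exponential squared moduli\<close>

text \<open>A disc of radius \<open>sqrt a\<close> has area \<open>pi * a\<close>, so both measures
  agree on the half-lines \<open>{..a}\<close>, an intersection-stable generator. This takes the
  place of polar coordinates.\<close>

lemma distr_cmod_sq_lborel:
  "distr lborel borel (\<lambda>z::complex. (cmod z)\<^sup>2) =
     density lborel (\<lambda>x. ennreal pi * indicator {0..} x)" (is "?M = ?N")
proof (rule measure_eqI_generator_eq[where \<Omega> = UNIV and E = "range (\<lambda>a::real. {..a})"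
      and A = "\<lambda>i. {..real i}"])
  show "Int_stable (range (\<lambda>a::real. {..a}))"
    by (auto simp: Int_stable_def)
  have atMost: "emeasure ?M {..a} = ennreal (pi * max 0 a)" for a
  proof -
    have "emeasure ?M {..a} = emeasure lborel {z::complex. (cmod z)\<^sup>2 \<le> a}"
      by (subst emeasure_distr) (auto simp: vimage_def)
    also have "\<dots> = ennreal (pi * max 0 a)"
    proof (cases "a \<ge> 0")
      case True
      then have "{z::complex. (cmod z)\<^sup>2 \<le> a} = cball 0 (sqrt a)"
        by (auto intro: real_le_rsqrt simp: sqrt_ge_absD)
      then show ?thesis
        using True by (simp add: emeasure_cball unit_ball_vol_2)
    next
      case False
      then have "{z::complex. (cmod z)\<^sup>2 \<le> a} = {}"
        by (auto simp: not_le intro: less_le_trans)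
      then show ?thesis
        using False by simp
    qed
    finally show ?thesis .
  qed
  have atMost': "emeasure ?N {..a} = ennreal (pi * max 0 a)" for a
  proof -
    have "emeasure ?N {..a} = (\<integral>\<^sup>+x. ennreal pi * indicator {0..a} x \<partial>lborel)"
      by (subst emeasure_density) (auto intro!: nn_integral_cong split: split_indicator)
    also have "\<dots> = ennreal (pi * max 0 a)"
      by (cases "a \<ge> 0") (simp_all add: nn_integral_cmult_indicator ennreal_mult')
    finally show ?thesis .
  qed
  show "emeasure ?M X = emeasure ?N X" if "X \<in> range (\<lambda>a::real. {..a})" for X
    using that atMost atMost' by auto
  show "sets ?M = sigma_sets UNIV (range (\<lambda>a::real. {..a}))"
    "sets ?N = sigma_sets UNIV (range (\<lambda>a::real. {..a}))"
    by (simp_all add: borel_eq_atMost)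
  show "range (\<lambda>i. {..real i}) \<subseteq> range (\<lambda>a::real. {..a})"
    by auto
  show "(\<Union>i. {..real i}) = UNIV"
    by (auto intro: real_arch_simple)
  show "emeasure ?M {..real i} \<noteq> \<infinity>" for i
    by (simp add: atMost)
qed simp

text \<open>The Gaussian density depends on \<open>z\<close> only through its squared modulus, so
  integrals against it move to the half-line, where the area factor \<open>pi\<close> cancels the
  \<open>pi\<close> of the normalisation.\<close>

lemma distributed_cmod_sq_circ_normal:
  assumes h: "distributed M lborel h (\<lambda>z. ennreal (circ_normal_density (inverse l) z))"
    and l: "0 < l"
  shows "distributed M lborel (\<lambda>\<omega>. (cmod (h \<omega>))\<^sup>2) (exponential_density l)"
proof -
  have [measurable]: "h \<in> borel_measurable M"
    using h by (auto simp: distributed_def)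
  have "distr M lborel (\<lambda>\<omega>. (cmod (h \<omega>))\<^sup>2) = density lborel (exponential_density l)"
  proof (rule measure_eqI)
    fix A assume "A \<in> sets (distr M lborel (\<lambda>\<omega>. (cmod (h \<omega>))\<^sup>2))"
    then have [measurable]: "A \<in> sets borel"
      by simp
    \<comment> \<open>The Gaussian density of variance \<open>inverse l\<close>, written as a
      function of the squared modulus \<open>x\<close> and restricted to \<open>A\<close>.\<close>
    let ?F = "\<lambda>x. ennreal (l / pi * exp (- l * x)) * indicator A x"
    have "emeasure (distr M lborel (\<lambda>\<omega>. (cmod (h \<omega>))\<^sup>2)) A
        = emeasure M (h -` {z. (cmod z)\<^sup>2 \<in> A} \<inter> space M)"
      by (subst emeasure_distr) (auto simp: vimage_def)
    also have "\<dots> = (\<integral>\<^sup>+z. ennreal (circ_normal_density (inverse l) z)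
        * indicator {z. (cmod z)\<^sup>2 \<in> A} z \<partial>lborel)"
      by (rule distributed_emeasure[OF h]) measurable
    also have "\<dots> = (\<integral>\<^sup>+z. ?F ((cmod z)\<^sup>2) \<partial>lborel)"
      by (intro nn_integral_cong)
        (auto simp: circ_normal_density_def field_simps split: split_indicator)
    also have "\<dots> = (\<integral>\<^sup>+x. ?F x \<partial>distr lborel borel (\<lambda>z::complex. (cmod z)\<^sup>2))"
      by (subst nn_integral_distr) auto
    also have "\<dots> = (\<integral>\<^sup>+x. ennreal pi * indicator {0..} x * ?F x \<partial>lborel)"
      unfolding distr_cmod_sq_lborel by (subst nn_integral_density) auto
    also have "\<dots> = (\<integral>\<^sup>+x. ennreal (exponential_density l x) * indicator A x \<partial>lborel)"
      using l by (intro nn_integral_cong)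
        (auto simp: exponential_density_def ennreal_mult'[symmetric] field_simps split: split_indicator)
    also have "\<dots> = emeasure (density lborel (exponential_density l)) A"
      by (subst emeasure_density) auto
    finally show "emeasure (distr M lborel (\<lambda>\<omega>. (cmod (h \<omega>))\<^sup>2)) A
        = emeasure (density lborel (exponential_density l)) A" .
  qed simp
  then show ?thesis
    by (auto simp: distributed_def)
qed

section \<open>Tails and comparison of exponential variables\<close>

context prob_space
begin

text \<open>A law with a density gives no mass to the point \<open>a\<close>, so the strict tail
  formula carries over to the non-strict thresholds of the model.\<close>

lemma exponential_distributedD_ge:
  assumes X: "distributed M lborel X (exponential_density l)" and "0 \<le> a" "0 < l"
  shows "\<P>(\<omega> in M. a \<le> X \<omega>) = exp (- a * l)"
proof -
  have [measurable]: "X \<in> borel_measurable M"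
    using X by (auto simp: distributed_def)
  have "emeasure M (X -` {a} \<inter> space M)
      = (\<integral>\<^sup>+x. ennreal (exponential_density l x) * indicator {a} x \<partial>lborel)"
    by (rule distributed_emeasure[OF X]) simp
  also have "\<dots> = 0"
    using AE_lborel_singleton[of a]
    by (subst nn_integral_0_iff_AE) (simp, elim eventually_mono, simp)
  finally have "AE \<omega> in M. X \<omega> \<noteq> a"
    by (intro AE_I[where N = "X -` {a} \<inter> space M"]) auto
  then have "\<P>(\<omega> in M. a \<le> X \<omega>) = \<P>(\<omega> in M. a < X \<omega>)"
    by (intro prob_eq_AE) (auto simp: less_le)
  then show ?thesis
    using exponential_distributedD_gt[OF X] assms by simp
qed

text \<open>Given \<open>Y = y \<ge> 0\<close>, the variable \<open>X\<close> exceeds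
  \<open>c * y\<close> with probability \<open>exp (- (c * y) * l)\<close>. Averaging over
  \<open>y\<close> multiplies this by the density of rate \<open>u\<close>, and the rates add up to
  \<open>u + l * c\<close>.\<close>

lemma exponential_distributed_prob_mult_le:
  assumes X: "distributed M lborel X (exponential_density l)"
    and Y: "distributed M lborel Y (exponential_density u)"
    and ind: "indep_var borel X borel Y"
    and l: "0 < l" and u: "0 < u" and c: "0 < c"
  shows "\<P>(\<omega> in M. c * Y \<omega> \<le> X \<omega>) = u / (u + l * c)"
proof -
  have [measurable]: "X \<in> borel_measurable M" "Y \<in> borel_measurable M"
    using X Y by (auto simp: distributed_def)
  interpret X: prob_space "distr M borel X"
    by (rule prob_space_distr) simp
  interpret Y: prob_space "distr M borel Y"
    by (rule prob_space_distr) simp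
  have distrY: "distr M borel Y = density lborel (exponential_density u)"
    using Y by (simp add: distributed_def cong: distr_cong)
  have sum: "0 < u + l * c"
    using l u c by (simp add: add_pos_pos)
  have [measurable]: "{p::real \<times> real. c * snd p \<le> fst p} \<in> sets (borel \<Otimes>\<^sub>M borel)"
    unfolding borel_prod by (intro borel_closed closed_Collect_le continuous_intros)
  have tail: "emeasure (distr M borel X) {x. c * y \<le> x} = exp (- (c * y) * l)" if "0 \<le> y" for y
  proof -
    have "emeasure (distr M borel X) {x. c * y \<le> x} = \<P>(\<omega> in M. c * y \<le> X \<omega>)"
      by (subst emeasure_distr) (auto simp: emeasure_eq_measure intro!: arg_cong[where f = prob])
    then show ?thesis
      using exponential_distributedD_ge[OF X _ l, of "c * y"] that c by simp
  qed
  have "\<P>(\<omega> in M. c * Y \<omega> \<le> X \<omega>)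
      = emeasure (distr M (borel \<Otimes>\<^sub>M borel) (\<lambda>\<omega>. (X \<omega>, Y \<omega>))) {p. c * snd p \<le> fst p}"
    by (subst emeasure_distr)
      (auto simp: emeasure_eq_measure space_pair_measure intro!: arg_cong[where f = prob])
  also have "\<dots> = emeasure (distr M borel X \<Otimes>\<^sub>M distr M borel Y) {p. c * snd p \<le> fst p}"
    using ind by (simp add: indep_var_distribution_eq)
  also have "\<dots> = (\<integral>\<^sup>+y. emeasure (distr M borel X) {x. c * y \<le> x} \<partial>distr M borel Y)"
  proof -
    interpret pair_sigma_finite "distr M borel X" "distr M borel Y" ..
    show ?thesis
      by (subst emeasure_pair_measure_alt2) (auto simp: vimage_def)
  qed
  also have "\<dots> = (\<integral>\<^sup>+y. ennreal (exponential_density u y) * emeasure (distr M borel X) {x. c * y \<le> x} \<partial>lborel)"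
    unfolding distrY by (subst nn_integral_density) auto
  \<comment> \<open>The product of density and tail is a constant times the exponential density of
    rate \<open>u + l * c\<close>, whose total mass is one, so no integral has to be
    computed.\<close>
  also have "\<dots> = (\<integral>\<^sup>+y. ennreal (u / (u + l * c)) * exponential_density (u + l * c) y \<partial>lborel)"
  proof (rule nn_integral_cong)
    fix y :: real
    show "ennreal (exponential_density u y) * emeasure (distr M borel X) {x. c * y \<le> x}
        = ennreal (u / (u + l * c)) * ennreal (exponential_density (u + l * c) y)"
    \<comment> \<open>The formula \<open>tail\<close> needs \<open>0 \<le> y\<close>; for negative
      \<open>y\<close> both densities vanish.\<close>
    proof (cases "y < 0")
      case False
      have "u * exp (- y * u) * exp (- (c * y) * l)
          = u / (u + l * c) * ((u + l * c) * exp (- y * (u + l * c)))"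
        using sum by (simp add: exp_add[symmetric] distrib_left mult_ac)
      then show ?thesis
        using False u sum by (simp add: exponential_density_def tail ennreal_mult'[symmetric])
    qed (simp add: exponential_density_def)
  qed
  also have "\<dots> = ennreal (u / (u + l * c)) * emeasure (density lborel (exponential_density (u + l * c))) UNIV"
    by (subst nn_integral_cmult) (auto simp: emeasure_density)
  also have "\<dots> = ennreal (u / (u + l * c))"
    using prob_space.emeasure_space_1[OF prob_space_exponential_density[OF sum]] by simp
  finally show ?thesis
    using u sum by (simp add: ennreal_inj)
qed

end


section \<open>Pointwise facts about the signal-to-noise ratios\<close>

lemma arg_max_on_ge_iff:
  fixes f :: "'b \<Rightarrow> 'c::linorder"
  assumes "finite S" "S \<noteq> {}"
  shows "c \<le> f (arg_max_on f S) \<longleftrightarrow> (\<exists>x\<in>S. c \<le> f x)"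
proof -
  obtain k where k: "k \<in> S" "\<And>x. x \<in> S \<Longrightarrow> f x \<le> f k"
    using assms Max_in[of "f ` S"] Max_ge[of "f ` S"]
    by (metis (no_types, lifting) finite_imageI image_iff image_is_empty)
  then have "f (arg_max_on f S) = f k"
    unfolding arg_max_on_def by (intro arg_max_equality) auto
  then show ?thesis
    using k order_trans by metis
qed

lemma gamma_th_pos: "admissible P \<Longrightarrow> 0 < gamma_th P"
  by (simp add: admissible_def gamma_th_def)

lemma xi_pos: "admissible P \<Longrightarrow> 0 < xi P"
  by (simp add: admissible_def xi_def split: eh_protocol.split)

lemma beta_pos: "admissible P \<Longrightarrow> 0 < beta P"
  by (simp add: admissible_def beta_def split: eh_protocol.split)

lemma psi_pos: "admissible P \<Longrightarrow> 0 < psi P"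
  using gamma_th_pos[of P] by (simp add: admissible_def psi_def)

lemma link_rate_pos: "admissible P \<Longrightarrow> 0 < link_rate P l"
  by (cases l) (simp_all add: admissible_def)

lemma norm_sr_sq_nonneg: "0 \<le> norm_sr_sq L h \<omega>"
  by (simp add: norm_sr_sq_def sum_nonneg)

text \<open>The relayed term is a product of nonnegative factors, also where a coefficient vanishes,
  since division by zero yields zero.\<close>

lemma Gamma_d1_le_Gamma_d:
  assumes "admissible P"
  shows "Gamma_d1 P h \<omega> \<le> Gamma_d P L h j \<omega>"
  using assms beta_pos[OF assms] norm_sr_sq_nonneg[of L h \<omega>]
  by (simp add: Gamma_d_def source_power_def admissible_def)

text \<open>Turns threshold events of the selected antenna into finite unions of events of single
  antennas. Neither the choice among ties nor the measurability of the selected index then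
  matters.\<close>

lemma Gamma_d_sel_ge_iff:
  assumes "1 \<le> L"
  shows "g \<le> Gamma_d_sel P L h \<omega> \<longleftrightarrow> (\<exists>j\<in>{1..L}. g \<le> Gamma_d P L h j \<omega>)"
  unfolding Gamma_d_sel_def selected_antenna_def
  using assms by (intro arg_max_on_ge_iff) auto

lemma Gamma_d1_le_Gamma_d_sel:
  assumes "admissible P" "1 \<le> L"
  shows "Gamma_d1 P h \<omega> \<le> Gamma_d_sel P L h \<omega>"
  unfolding Gamma_d_sel_ge_iff[OF assms(2)] using assms Gamma_d1_le_Gamma_d[OF assms(1)]
  \<comment> \<open>Any antenna can be the witness; \<open>1\<close> is in range because
    \<open>1 \<le> L\<close>.\<close>
  by (intro bexI[of _ 1]) auto

section \<open>Probability estimates for a fixed number of antennas\<close>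

text \<open>The model for one fixed \<open>L\<close>. Different \<open>L\<close> may live on
  unrelated probability spaces, so everything proved here is a numerical identity or bound that can
  be compared across \<open>L\<close>.\<close>

locale relay_channel = prob_space M
  for M :: "'a measure" and P :: relay_params and L :: nat and h :: "link \<Rightarrow> 'a \<Rightarrow> complex" +
  assumes adm: "admissible P" and L: "1 \<le> L"
    and indep: "indep_vars (\<lambda>_. borel) h (links L)"
    and circ_normal: "l \<in> links L \<Longrightarrow> distributed M lborel (h l)
        (\<lambda>z. ennreal (circ_normal_density (inverse (link_rate P l)) z))"
begin

lemma link_measurable: "l \<in> links L \<Longrightarrow> h l \<in> borel_measurable M"
  using circ_normal by (auto simp: distributed_def)

lemma links_measurable [measurable]:
  "h SD \<in> borel_measurable M" "h SP \<in> borel_measurable M"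
  "i \<in> {1..L} \<Longrightarrow> h (SR i) \<in> borel_measurable M"
  "i \<in> {1..L} \<Longrightarrow> h (RD i) \<in> borel_measurable M"
  "i \<in> {1..L} \<Longrightarrow> h (RP i) \<in> borel_measurable M"
  by (rule link_measurable; simp add: links_def)+

lemma norm_sr_sq_measurable [measurable]: "norm_sr_sq L h \<in> borel_measurable M"
  unfolding norm_sr_sq_def by measurable

lemma source_power_measurable [measurable]: "source_power P h \<in> borel_measurable M"
  unfolding source_power_def by measurable

lemma Gamma_r_measurable [measurable]: "Gamma_r P L h \<in> borel_measurable M"
  unfolding Gamma_r_def by measurable

lemma Gamma_d1_measurable [measurable]: "Gamma_d1 P h \<in> borel_measurable M"
  unfolding Gamma_d1_def by measurable

lemma Gamma_d_measurable [measurable]: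
  "j \<in> {1..L} \<Longrightarrow> Gamma_d P L h j \<in> borel_measurable M"
  unfolding Gamma_d_def by measurable

lemma Gamma_d_sel_ge_sets [measurable]: "{\<omega> \<in> space M. g \<le> Gamma_d_sel P L h \<omega>} \<in> events"
  unfolding Gamma_d_sel_ge_iff[OF L] by measurable

lemma exponential_link:
  "l \<in> links L \<Longrightarrow> distributed M lborel (\<lambda>\<omega>. (cmod (h l \<omega>))\<^sup>2) (exponential_density (link_rate P l))"
  using circ_normal link_rate_pos[OF adm] by (rule distributed_cmod_sq_circ_normal)

lemma SP_in_links: "SP \<in> links L" and SD_in_links: "SD \<in> links L"
  by (simp_all add: links_def)

lemma indep_cmod_sq: "indep_vars (\<lambda>_. borel) (\<lambda>l \<omega>. (cmod (h l \<omega>))\<^sup>2) (links L)"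
  using indep by (rule indep_vars_compose2) measurable

text \<open>Allows the denominator of \<open>source_power\<close> to be cleared almost
  surely.\<close>

lemma AE_SP_nonzero: "AE \<omega> in M. h SP \<omega> \<noteq> 0"
proof (rule AE_I)
  have "\<P>(\<omega> in M. (cmod (h SP \<omega>))\<^sup>2 \<le> 0) = 0"
    using exponential_distributedD_le[OF exponential_link[OF SP_in_links], of 0]
      link_rate_pos[OF adm, of SP] by simp
  then show "emeasure M {\<omega> \<in> space M. h SP \<omega> = 0} = 0"
    by (simp add: emeasure_eq_measure)
qed auto

text \<open>Off the null set where \<open>h SP\<close> vanishes, the event compares two independent
  exponentials, the gain of \<open>SD\<close> and \<open>psi P\<close> times the gain of
  \<open>SP\<close>.\<close>

lemma prob_Gamma_d1:
  "\<P>(\<omega> in M. gamma_th P \<le> Gamma_d1 P h \<omega>) = 1 / (1 + lam_sd P * psi P / lam_sp P)"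
proof -
  have pos: "0 < lam_sd P" "0 < lam_sp P" "0 < I_lim P" "0 < N_o P"
    using adm by (auto simp: admissible_def)
  have "\<P>(\<omega> in M. gamma_th P \<le> Gamma_d1 P h \<omega>)
      = \<P>(\<omega> in M. psi P * (cmod (h SP \<omega>))\<^sup>2 \<le> (cmod (h SD \<omega>))\<^sup>2)"
    using AE_SP_nonzero pos
    by (intro prob_eq_AE) (auto simp: Gamma_d1_def source_power_def psi_def field_simps)
  also have "\<dots> = lam_sp P / (lam_sp P + lam_sd P * psi P)"
  proof (rule exponential_distributed_prob_mult_le)
    show "indep_var borel (\<lambda>\<omega>. (cmod (h SD \<omega>))\<^sup>2) borel (\<lambda>\<omega>. (cmod (h SP \<omega>))\<^sup>2)"
      \<comment> \<open>Restricting the family to the disjoint index sets \<open>{SD}\<close> and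
        \<open>{SP}\<close> gives two independent function-valued variables; evaluation recovers the
        two gains.\<close>
      using indep_var_compose[OF indep_var_restrict[OF indep_cmod_sq, of "{SD}" "{SP}"],
          of "\<lambda>f. f SD" borel "\<lambda>f. f SP" borel] SP_in_links SD_in_links
      by (simp add: comp_def)
  qed (use exponential_link[OF SP_in_links] exponential_link[OF SD_in_links] pos psi_pos[OF adm] in auto)
  also have "\<dots> = 1 / (1 + lam_sd P * psi P / lam_sp P)"
    using pos by (simp add: field_simps)
  finally show ?thesis .
qed

text \<open>Independence yields \<open>L\<close> equal factors, each below one, hence geometric
  decay in \<open>L\<close> for fixed \<open>a\<close>.\<close>

lemma prob_all_SR_le:
  assumes "0 \<le> a"
  shows "\<P>(\<omega> in M. \<forall>i\<in>{1..L}. (cmod (h (SR i) \<omega>))\<^sup>2 \<le> a) = (1 - exp (- a * lam_sr P)) ^ L"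
proof -
  let ?E = "\<lambda>l. (\<lambda>\<omega>. (cmod (h l \<omega>))\<^sup>2) -` {..a} \<inter> space M"
  have sub: "SR ` {1..L} \<subseteq> links L"
    by (auto simp: links_def)
  have E: "prob (?E l) = 1 - exp (- a * lam_sr P)" if "l \<in> SR ` {1..L}" for l
  proof -
    have "?E l = {\<omega> \<in> space M. (cmod (h l \<omega>))\<^sup>2 \<le> a}"
      by auto
    then show ?thesis
      using exponential_distributedD_le[OF exponential_link, of l a] that sub assms
        link_rate_pos[OF adm, of l] by auto
  qed
  have "\<P>(\<omega> in M. \<forall>i\<in>{1..L}. (cmod (h (SR i) \<omega>))\<^sup>2 \<le> a) = prob (\<Inter>l\<in>SR ` {1..L}. ?E l)"
    using L by (intro arg_cong[where f = prob]) auto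
  also have "\<dots> = (\<Prod>l\<in>SR ` {1..L}. prob (?E l))"
    using L by (intro indep_varsD[OF indep_cmod_sq] sub) auto
  also have "\<dots> = (1 - exp (- a * lam_sr P)) ^ card (SR ` {1..L})"
    by (simp add: E)
  also have "card (SR ` {1..L}) = L"
    by (simp add: card_image inj_on_def)
  finally show ?thesis .
qed

text \<open>If the primary channel gain is at most \<open>K\<close>, decoding fails at the relay only if all
  source-relay gains are bounded by a fixed multiple of \<open>K\<close>.\<close>

lemma prob_Gamma_r_less:
  assumes K: "0 \<le> K"
  shows "\<P>(\<omega> in M. Gamma_r P L h \<omega> < gamma_th P)
      \<le> exp (- K * lam_sp P) + (1 - exp (- (psi P / xi P * K) * lam_sr P)) ^ L"
proof -
  let ?X = "\<lambda>i \<omega>. (cmod (h (SR i) \<omega>))\<^sup>2" and ?Y = "\<lambda>\<omega>. (cmod (h SP \<omega>))\<^sup>2"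
  \<comment> \<open>Relay failure bounds \<open>norm_sr_sq\<close> by \<open>psi P / xi P\<close>
    times the gain of \<open>SP\<close>; replacing that gain by its cap \<open>K\<close> gives
    \<open>?a\<close>.\<close>
  let ?a = "psi P / xi P * K"
  have pos: "0 < I_lim P" "0 < N_o P" "0 < lam_sp P" "0 < xi P" "0 < psi P"
    using adm xi_pos psi_pos by (auto simp: admissible_def)
  have "AE \<omega> in M. Gamma_r P L h \<omega> < gamma_th P \<longrightarrow> K < ?Y \<omega> \<or> (\<forall>i\<in>{1..L}. ?X i \<omega> \<le> ?a)"
    using AE_SP_nonzero
  proof eventually_elim
    case (elim \<omega>)
    have "?X i \<omega> \<le> ?a"
      if less: "Gamma_r P L h \<omega> < gamma_th P" and Y: "?Y \<omega> \<le> K" and i: "i \<in> {1..L}" for i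
    proof -
      have "?X i \<omega> \<le> norm_sr_sq L h \<omega>"
        unfolding norm_sr_sq_def using i by (intro member_le_sum) auto
      also have "\<dots> \<le> psi P / xi P * ?Y \<omega>"
        using less pos elim by (simp add: Gamma_r_def source_power_def psi_def field_simps)
      also have "\<dots> \<le> ?a"
        using Y pos by (intro mult_left_mono) auto
      finally show ?thesis .
    qed
    then show ?case
      by (auto simp: not_less)
  qed
  then have "\<P>(\<omega> in M. Gamma_r P L h \<omega> < gamma_th P)
      \<le> prob ({\<omega> \<in> space M. K < ?Y \<omega>} \<union> {\<omega> \<in> space M. \<forall>i\<in>{1..L}. ?X i \<omega> \<le> ?a})"
    by (intro finite_measure_mono_AE) auto
  \<comment> \<open>The union bound at the cutoff \<open>K\<close> avoids integrating over the gain
    of \<open>SP\<close>, which is common to all antennas.\<close>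
  also have "\<dots> \<le> \<P>(\<omega> in M. K < ?Y \<omega>) + \<P>(\<omega> in M. \<forall>i\<in>{1..L}. ?X i \<omega> \<le> ?a)"
    by (intro measure_Un_le) auto
  also have "\<P>(\<omega> in M. K < ?Y \<omega>) = exp (- K * lam_sp P)"
    using exponential_distributedD_gt[OF exponential_link[OF SP_in_links] K] pos by simp
  also have "\<P>(\<omega> in M. \<forall>i\<in>{1..L}. ?X i \<omega> \<le> ?a) = (1 - exp (- ?a * lam_sr P)) ^ L"
    using K pos by (intro prob_all_SR_le) auto
  finally show ?thesis .
qed

text \<open>The two bounds differ only by a multiple of \<open>B\<close>, and the value of
  \<open>A\<close> does not depend on \<open>L\<close>, so the limit reduces to showing that
  \<open>B\<close> vanishes.\<close>

lemma tau_diff_bounds: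
  defines "A \<equiv> \<P>(\<omega> in M. gamma_th P \<le> Gamma_d1 P h \<omega>)"
    and "B \<equiv> \<P>(\<omega> in M. Gamma_r P L h \<omega> < gamma_th P)"
  shows "1 / 2 * zeta P * R_s P * A \<le> tau_in P L M h - tau_coop P L M h"
    and "tau_in P L M h - tau_coop P L M h \<le> 1 / 2 * zeta P * R_s P * (A + B)"
proof -
  \<comment> \<open>\<open>EA\<close> is success of the direct link, \<open>EB\<close> failure of
    decoding at the relay, \<open>EC\<close> success of the cooperative scheme.\<close>
  define EA where "EA = {\<omega> \<in> space M. gamma_th P \<le> Gamma_d1 P h \<omega>}"
  define EB where "EB = {\<omega> \<in> space M. Gamma_r P L h \<omega> < gamma_th P}"
  define EC where "EC = {\<omega> \<in> space M. gamma_th P \<le> Gamma_r P L h \<omega> \<and> gamma_th P \<le> Gamma_d_sel P L h \<omega>}"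
  have sets [measurable]: "EA \<in> events" "EB \<in> events" "EC \<in> events"
    unfolding EA_def EB_def EC_def by measurable
  have "outage P L M h = prob (space M - EC)"
    unfolding outage_def EC_def by (intro arg_cong[where f = prob]) (auto simp: min_less_iff_disj)
  then have coop: "tau_coop P L M h = 1 / 2 * R_s P * zeta P * prob EC"
    by (simp add: tau_coop_def prob_compl)
  have "\<P>(\<omega> in M. Gamma_d1 P h \<omega> < gamma_th P \<and> gamma_th P \<le> Gamma_r P L h \<omega>
      \<and> gamma_th P \<le> Gamma_d_sel P L h \<omega>) = prob (EC - EA)"
    unfolding EC_def EA_def by (intro arg_cong[where f = prob]) auto
  then have "tau_in P L M h = zeta P * (1 / 2 * R_s P * prob (EC - EA) + R_s P * prob EA)"
    by (simp add: tau_in_def EA_def)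
  moreover have "prob (EC - EA) = prob EC - prob (EC \<inter> EA)"
    by (rule finite_measure_Diff') auto
  \<comment> \<open>The terms \<open>prob EC\<close> cancel. The full rate on \<open>EA\<close>
    counts \<open>prob EA\<close> twice in units of half the rate, and one copy is reduced by the
    overlap with \<open>EC\<close>.\<close>
  ultimately have diff: "tau_in P L M h - tau_coop P L M h
      = 1 / 2 * zeta P * R_s P * (prob EA + (prob EA - prob (EC \<inter> EA)))"
    using coop by (simp add: algebra_simps)
  have zR: "0 \<le> 1 / 2 * zeta P * R_s P"
    using adm by (auto simp: admissible_def zeta_def split: eh_protocol.split)
  \<comment> \<open>On \<open>EA\<close> the selected antenna also reaches the threshold, so only
    the relay can prevent \<open>EC\<close>.\<close>
  have "EA \<subseteq> (EC \<inter> EA) \<union> EB"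
    using order_trans[OF _ Gamma_d1_le_Gamma_d_sel[OF adm L]]
    by (auto simp: EA_def EB_def EC_def not_less)
  then have "prob EA \<le> prob ((EC \<inter> EA) \<union> EB)"
    by (intro finite_measure_mono) auto
  also have "\<dots> \<le> prob (EC \<inter> EA) + prob EB"
    by (intro measure_Un_le) auto
  finally have le: "prob EA - prob (EC \<inter> EA) \<le> prob EB"
    by simp
  have ge: "0 \<le> prob EA - prob (EC \<inter> EA)"
    by (simp add: finite_measure_mono)
  show "1 / 2 * zeta P * R_s P * A \<le> tau_in P L M h - tau_coop P L M h"
    unfolding diff A_def EA_def[symmetric] using ge zR by (intro mult_left_mono) auto
  show "tau_in P L M h - tau_coop P L M h \<le> 1 / 2 * zeta P * R_s P * (A + B)"
    unfolding diff A_def B_def EA_def[symmetric] EB_def[symmetric] using le zR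
    by (intro mult_left_mono) auto
qed

end

section \<open>Passage to the limit in the number of antennas\<close>

lemma relay_channelI:
  assumes "admissible P" "1 \<le> L" "channel_model P L M h"
  shows "relay_channel M P L h"
proof -
  interpret prob_space M
    using assms by (simp add: channel_model_def)
  show ?thesis
    using assms by unfold_locales (auto simp: channel_model_def)
qed

theorem lemmaV5:
  fixes P :: relay_params
    and M :: "nat \<Rightarrow> 'a measure"
    and h :: "nat \<Rightarrow> link \<Rightarrow> 'a \<Rightarrow> complex"
  assumes "admissible P"
    and "\<And>L. L \<ge> 1 \<Longrightarrow> channel_model P L (M L) (h L)"
  shows "(\<lambda>L. tau_in P L (M L) (h L) - tau_coop P L (M L) (h L))
           \<longlonglongrightarrow> (1 / 2 * zeta P * R_s P) / (1 + lam_sd P * psi P / lam_sp P)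
       \<and> (\<forall>L\<ge>1. (1 / 2 * zeta P * R_s P) / (1 + lam_sd P * psi P / lam_sp P)
                   = 1 / 2 * zeta P * tau_dir P (M L) (h L))"
proof
  define A where "A = 1 / (1 + lam_sd P * psi P / lam_sp P)"
  define B where "B L = \<P>(\<omega> in M L. Gamma_r P L (h L) \<omega> < gamma_th P)" for L
  have channel: "relay_channel (M L) P L (h L)" if "1 \<le> L" for L
    using assms that by (intro relay_channelI)
  have pos: "0 < lam_sp P"
    using assms(1) by (simp add: admissible_def)
  have B: "B \<longlonglongrightarrow> 0"
  proof (rule order_tendstoI)
    fix \<epsilon> :: real assume "0 < \<epsilon>"
    have "((\<lambda>K. exp (- K * lam_sp P)) \<longlongrightarrow> 0) at_top"
      using pos by real_asymp
    then have "eventually (\<lambda>K. exp (- K * lam_sp P) < \<epsilon> / 2 \<and> 0 \<le> K) at_top"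
      using \<open>0 < \<epsilon>\<close> by (intro eventually_conj order_tendstoD eventually_ge_at_top) auto
    \<comment> \<open>The cutoff is chosen from \<open>\<epsilon>\<close> alone, before
      \<open>L\<close> grows, so that the base of the power below stays fixed.\<close>
    then obtain K where K: "exp (- K * lam_sp P) < \<epsilon> / 2" "0 \<le> K"
      by (auto dest!: eventually_happens)
    have "0 \<le> psi P / xi P * K * lam_sr P"
      using psi_pos[OF assms(1)] xi_pos[OF assms(1)] K assms(1) by (simp add: admissible_def)
    \<comment> \<open>The exponent is nonpositive, so the exponential lies in \<open>(0, 1]\<close>
      and the base in \<open>[0, 1)\<close>.\<close>
    then have "(\<lambda>L. (1 - exp (- (psi P / xi P * K) * lam_sr P)) ^ L) \<longlonglongrightarrow> 0"
      by (intro LIMSEQ_power_zero) (auto simp: abs_if)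
    then have "eventually (\<lambda>L. (1 - exp (- (psi P / xi P * K) * lam_sr P)) ^ L < \<epsilon> / 2) sequentially"
      using \<open>0 < \<epsilon>\<close> by (intro order_tendstoD) auto
    then show "eventually (\<lambda>L. B L < \<epsilon>) sequentially"
      \<comment> \<open>The channel model is available only from \<open>L = 1\<close> on.\<close>
      using eventually_ge_at_top[of 1]
    proof eventually_elim
      case (elim L)
      then show ?case
        using relay_channel.prob_Gamma_r_less[OF channel K(2), of L] K(1) by (simp add: B_def)
    qed
  next
    fix a :: real assume "a < 0"
    then show "eventually (\<lambda>L. a < B L) sequentially"
      unfolding B_def by (intro always_eventually allI) (rule less_le_trans[OF _ measure_nonneg])
  qed
  have "(\<lambda>L. tau_in P L (M L) (h L) - tau_coop P L (M L) (h L)) \<longlonglongrightarrow> 1 / 2 * zeta P * R_s P * A"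
  proof (rule tendsto_sandwich)
    show "eventually (\<lambda>L. 1 / 2 * zeta P * R_s P * A
        \<le> tau_in P L (M L) (h L) - tau_coop P L (M L) (h L)) sequentially"
      using eventually_ge_at_top[of 1] by eventually_elim
        (use relay_channel.tau_diff_bounds(1)[OF channel] relay_channel.prob_Gamma_d1[OF channel]
          in \<open>simp add: A_def\<close>)
    show "eventually (\<lambda>L. tau_in P L (M L) (h L) - tau_coop P L (M L) (h L)
        \<le> 1 / 2 * zeta P * R_s P * (A + B L)) sequentially"
      using eventually_ge_at_top[of 1] by eventually_elim
        (use relay_channel.tau_diff_bounds(2)[OF channel] relay_channel.prob_Gamma_d1[OF channel]
          in \<open>simp add: A_def B_def\<close>)
    have "(\<lambda>L. 1 / 2 * zeta P * R_s P * (A + B L)) \<longlonglongrightarrow> 1 / 2 * zeta P * R_s P * (A + 0)"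
      by (intro tendsto_intros B)
    then show "(\<lambda>L. 1 / 2 * zeta P * R_s P * (A + B L)) \<longlonglongrightarrow> 1 / 2 * zeta P * R_s P * A"
      by simp
  qed simp
  then show "(\<lambda>L. tau_in P L (M L) (h L) - tau_coop P L (M L) (h L))
      \<longlonglongrightarrow> (1 / 2 * zeta P * R_s P) / (1 + lam_sd P * psi P / lam_sp P)"
    by (simp add: A_def)
  \<comment> \<open>The event in \<open>tau_dir\<close> is the direct-link event for
    \<open>Gamma_d1\<close>, so its exact probability applies for each \<open>L\<close>.\<close>
  show "\<forall>L\<ge>1. (1 / 2 * zeta P * R_s P) / (1 + lam_sd P * psi P / lam_sp P)
      = 1 / 2 * zeta P * tau_dir P (M L) (h L)"
    using relay_channel.prob_Gamma_d1[OF channel] by (simp add: tau_dir_def Gamma_d1_def)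
qed

end
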